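(* Let $H$ be a braided vector space, $V$ a vector space, and let $U\subset H'$, $W\subset V'$ be non-degenerate subspaces such that $\Psi_{UU}$ is bijective. (1) Let $V$ be a left $H$-braided vector space and assume that $\Psi_{WH}$ and $\Psi_{VU}$ are bijective. Consider the maps $U\otimes W\to(V\otimes H)'$ given by $\Psi_{H'W}(f\otimes e)(v\otimes a):=\langle\langle v\otimes f,\Psi_{WH}(e\otimes a)\rangle\rangle$ and $\Psi_{UV'}(f\otimes e)(v\otimes a):=\langle\langle e\otimes a,\Psi_{VU}(v\otimes f)\rangle\rangle$. If one of them is a bijection $U\otimes W\to W\otimes U\subset(V\otimes H)'$, then so is the other, and they are equal (the common map being denoted $\Psi_{UW}$). (2) Let $V$ be a left $H$-braided vector space and assume that $\Psi_{HW}^\circ$ and $\Psi_{UV}^\circ$ are bijective. Consider the maps $W\otimes U\to(H\otimes V)'$ given by $\Psi_{V'U}^\bullet(e\otimes f)(a\otimes v):=\langle\langle a\otimes e,\Psi_{UV}^\circ(f\otimes v)\rangle\rangle$ and $\Psi_{WH'}^\bullet(e\otimes f)(a\otimes v):=\langle\langle f\otimes v,\Psi_{HW}^\circ(a\otimes e)\rangle\rangle$. If one of them is a bijection $W\otimes U\to U\otimes W\subset(H\otimes V)'$, then they are equal (the common map being denoted $\Psi_{WU}^\bullet$). (3) Let $V$ be a right $H$-braided vector space. If $\Psi_{HW}$ and $\Psi_{UV}$ are bijective and one of the maps $W\otimes U\to(H\otimes V)'$, $(e\otimes f)\mapsto\big(a\otimes v\mapsto\langle\langle a\otimes e,\Psi_{UV}(f\otimes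 v)\rangle\rangle\big)$ and $(e\otimes f)\mapsto\big(a\otimes v\mapsto\langle\langle f\otimes v,\Psi_{HW}(a\otimes e)\rangle\rangle\big)$, is a bijection onto $U\otimes W$, then so is the other and they are equal (denoted $\Psi_{WU}$). If $\Psi_{VU}^\circ$ and $\Psi_{WH}^\circ$ are bijective and one of the maps $U\otimes W\to(V\otimes H)'$, $(f\otimes e)\mapsto\big(v\otimes a\mapsto\langle\langle e\otimes a,\Psi_{VU}^\circ(v\otimes f)\rangle\rangle\big)$ and $(f\otimes e)\mapsto\big(v\otimes a\mapsto\langle\langle v\otimes f,\Psi_{WH}^\circ(e\otimes a)\rangle\rangle\big)$, is a bijection onto $W\otimes U$, then they are equal (denoted $\Psi_{UW}^\bullet$).
   Context: All vector spaces are over a fixed field $\mathbb K$, $\otimes$ is the algebraic tensor product, $X'$ is the full linear dual of $X$, and composition of maps is written by juxtaposition. A braiding on $V$ is a bijective linear map $\Psi_{VV}:V\otimes V\to V\otimes V$ with $(\Psi_{VV}\otimes\mathrm{id})(\mathrm{id}\otimes\Psi_{VV})(\Psi_{VV}\otimes\mathrm{id})=(\mathrm{id}\otimes\Psi_{VV})(\Psi_{VV}\otimes\mathrm{id})(\mathrm{id}\otimes\Psi_{VV})$; $V$ is then a braided vector space. Let $\Psi_{VW}:V\otimes W\to W\otimes V$ be bijective and linear. If $V$ is braided, $W$ is a left $V$-braided vector space if $(\Psi_{VW}\otimes\mathrm{id})(\mathrm{id}\otimes\Psi_{VW})(\Psi_{VV}\otimes\mathrm{id})=(\mathrm{id}\otimes\Psi_{VV})(\Psi_{VW}\otimes\mathrm{id})(\mathrm{id}\otimes\Psi_{VW})$.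 If $W$ is braided, $V$ is a right $W$-braided vector space if $(\mathrm{id}\otimes\Psi_{VW})(\Psi_{VW}\otimes\mathrm{id})(\mathrm{id}\otimes\Psi_{WW})=(\Psi_{WW}\otimes\mathrm{id})(\mathrm{id}\otimes\Psi_{VW})(\Psi_{VW}\otimes\mathrm{id})$. Duality notation: $\langle f,a\rangle=\langle a,f\rangle=f(a)$. A subspace of $X'$ is non-degenerate if it separates the points of $X$. $\langle\langle\xi\otimes\eta,x\otimes y\rangle\rangle:=\langle\xi,y\rangle\langle\eta,x\rangle$. Tensor products are embedded into duals by $(\xi\otimes\eta)(x\otimes y)=\langle\xi,x\rangle\langle\eta,y\rangle$. In the claim $a\in H$, $v\in V$, $f\in U$, $e\in W$. Define $\Psi_{UU}(f\otimes g)(b\otimes a):=\langle\langle f\otimes g,\Psi_{HH}(a\otimes b)\rangle\rangle$ (values in $(H\otimes H)'\supset U\otimes U$). For $V$ left $H$-braided via $\Psi_{HV}:H\otimes V\to V\otimes H$: $\Psi_{WH}(e\otimes a)(f\otimes v):=\langle\langle f\otimes e,\Psi_{HV}(a\otimes v)\rangle\rangle$, $e\in W$, $f\in H'$ (values in $(H'\otimes V)'\supset H\otimes W$); $\Psi_{VU}(v\otimes f)(a\otimes e):=\langle\langle f\otimes e,\Psi_{HV}(a\otimes v)\rangle\rangle$, $f\in U$, $e\in V'$ (values in $(H\otimes V')'\supset U\otimes V$); $\Psi_{HW}^\circ(a\otimes e)(v\otimes f):=\langle\langle e\otimes f,\Psi_{HV}^{-1}(v\otimes a)\rangle\rangle$,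 $e\in W$, $f\in H'$ (values in $(V\otimes H')'\supset W\otimes H$); $\Psi_{UV}^\circ(f\otimes v)(e\otimes a):=\langle\langle e\otimes f,\Psi_{HV}^{-1}(v\otimes a)\rangle\rangle$, $f\in U$, $e\in V'$ (values in $(V'\otimes H)'\supset V\otimes U$). For $V$ right $H$-braided via $\Psi_{VH}:V\otimes H\to H\otimes V$: $\Psi_{HW}(a\otimes e)(v\otimes f):=\langle\langle e\otimes f,\Psi_{VH}(v\otimes a)\rangle\rangle$, $e\in W$, $f\in H'$ (values in $(V\otimes H')'\supset W\otimes H$); $\Psi_{UV}(f\otimes v)(e\otimes a):=\langle\langle e\otimes f,\Psi_{VH}(v\otimes a)\rangle\rangle$, $f\in U$, $e\in V'$ (values in $(V'\otimes H)'\supset V\otimes U$); $\Psi_{WH}^\circ(e\otimes a)(f\otimes v):=\langle\langle f\otimes e,\Psi_{VH}^{-1}(a\otimes v)\rangle\rangle$, $e\in W$, $f\in H'$ (values in $(H'\otimes V)'\supset H\otimes W$); $\Psi_{VU}^\circ(v\otimes f)(a\otimes e):=\langle\langle f\otimes e,\Psi_{VH}^{-1}(a\otimes v)\rangle\rangle$, $f\in U$, $e\in V'$ (values in $(H\otimes V')'\supset U\otimes V$). Such a map $\Psi_{XY}$ is called bijective if it is a bijection $X\otimes Y\to Y\otimes X$. *)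

theory Defs
  imports Complex_Main "HOL-Library.Function_Algebras"
begin

section \<open>Vector spaces with carriers, linear maps and duals\<close>

text \<open>Subspaces of duals and algebraic tensor products occur side by side, so a vector space is
  given by a subspace (the carrier) of an ambient type with a scalar multiplication.\<close>

record ('k, 'v) vspace =
  smul :: "'k \<Rightarrow> 'v \<Rightarrow> 'v"
  carr :: "'v set"

definition is_vspace :: "('k::field, 'v::ab_group_add) vspace \<Rightarrow> bool" where
  "is_vspace E \<longleftrightarrow> vector_space (smul E) \<and> module.subspace (smul E) (carr E)"

definition is_subspace_of ::
    "('k::field, 'v::ab_group_add) vspace \<Rightarrow> ('k, 'v) vspace \<Rightarrow> bool" where
  "is_subspace_of U E \<longleftrightarrow> is_vspace U \<and> smul U = smul E \<and> carr U \<subseteq> carr E"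

definition linmap ::
    "('k, 'v::ab_group_add) vspace \<Rightarrow> ('k, 'w::ab_group_add) vspace \<Rightarrow> ('v \<Rightarrow> 'w) \<Rightarrow> bool" where
  "linmap E F f \<longleftrightarrow>
     (\<forall>x\<in>carr E. f x \<in> carr F) \<and>
     (\<forall>x\<in>carr E. \<forall>y\<in>carr E. f (x + y) = f x + f y) \<and>
     (\<forall>c. \<forall>x\<in>carr E. f (smul E c x) = smul F c (f x))"

definition bilinmap ::
    "('k, 'v::ab_group_add) vspace \<Rightarrow> ('k, 'w::ab_group_add) vspace \<Rightarrow>
     ('k, 'z::ab_group_add) vspace \<Rightarrow> ('v \<Rightarrow> 'w \<Rightarrow> 'z) \<Rightarrow> bool" where
  "bilinmap E F G b \<longleftrightarrow>
     (\<forall>x\<in>carr E. linmap F G (b x)) \<and> (\<forall>y\<in>carr F. linmap E G (\<lambda>x. b x y))"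

definition scalars :: "('k::field, 'k) vspace" where
  "scalars = \<lparr>smul = (*), carr = UNIV\<rparr>"

definition fscale :: "'k::field \<Rightarrow> ('a \<Rightarrow> 'k) \<Rightarrow> 'a \<Rightarrow> 'k" where
  "fscale c f = (\<lambda>x. c * f x)"

text \<open>The full linear dual. Functionals are normalised to vanish outside the carrier, so that
  functionals that agree on the carrier are equal.\<close>

definition dual :: "('k::field, 'v::ab_group_add) vspace \<Rightarrow> ('k, 'v \<Rightarrow> 'k) vspace" where
  "dual E = \<lparr>smul = fscale,
             carr = {f. linmap E scalars f \<and> (\<forall>x. x \<notin> carr E \<longrightarrow> f x = 0)}\<rparr>"

definition nondegenerate ::
    "('k, 'v \<Rightarrow> 'k) vspace \<Rightarrow> ('k, 'v) vspace \<Rightarrow> bool" where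
  "nondegenerate U E \<longleftrightarrow> (\<forall>x\<in>carr E. \<forall>y\<in>carr E. x \<noteq> y \<longrightarrow> (\<exists>f\<in>carr U. f x \<noteq> f y))"

section \<open>The algebraic tensor product\<close>

text \<open>The tensor \<open>x \<otimes> y\<close> is realised as evaluation of bilinear forms at \<open>(x, y)\<close>, and
  \<open>E \<otimes> F\<close> as the linear span of these evaluations. The theorems \<open>tensor_universal\<close> and
  \<open>tensor_map_unique\<close> below are the universal property.\<close>

definition tens ::
    "('k::field, 'v::ab_group_add) vspace \<Rightarrow> ('k, 'w::ab_group_add) vspace \<Rightarrow>
     'v \<Rightarrow> 'w \<Rightarrow> (('v \<Rightarrow> 'w \<Rightarrow> 'k) \<Rightarrow> 'k)" where
  "tens E F x y = (\<lambda>\<beta>. if bilinmap E F scalars \<beta> then \<beta> x y else 0)"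

definition tensor ::
    "('k::field, 'v::ab_group_add) vspace \<Rightarrow> ('k, 'w::ab_group_add) vspace \<Rightarrow>
     ('k, ('v \<Rightarrow> 'w \<Rightarrow> 'k) \<Rightarrow> 'k) vspace"  (infixl "\<otimes>" 70) where
  "E \<otimes> F = \<lparr>smul = fscale,
            carr = module.span fscale {tens E F x y | x y. x \<in> carr E \<and> y \<in> carr F}\<rparr>"

text \<open>In this realisation a bilinear form \<open>\<beta>\<close> induces the linear form \<open>t \<mapsto> t \<beta>\<close>. Accordingly the
  linear extension of a bilinear map into a space of scalar functions is obtained pointwise.\<close>

definition lift :: "('v \<Rightarrow> 'w \<Rightarrow> 'a \<Rightarrow> 'k) \<Rightarrow> (('v \<Rightarrow> 'w \<Rightarrow> 'k) \<Rightarrow> 'k) \<Rightarrow> 'a \<Rightarrow> 'k" where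
  "lift b t = (\<lambda>z. t (\<lambda>x y. b x y z))"

lemma vector_space_fscale: "vector_space fscale"
  by unfold_locales (auto simp: fscale_def algebra_simps fun_eq_iff)

lemma tens_in_tensor: "x \<in> carr E \<Longrightarrow> y \<in> carr F \<Longrightarrow> tens E F x y \<in> carr (E \<otimes> F)"
  using vector_space_fscale
  by (auto simp: tensor_def module_iff_vector_space intro!: module.span_base)

lemma is_vspace_tensor: "is_vspace (E \<otimes> F)"
  using vector_space_fscale
  by (auto simp: is_vspace_def tensor_def module_iff_vector_space intro!: module.subspace_span)

lemma lift_tens:
  assumes "bilinmap E F \<lparr>smul = fscale, carr = A\<rparr> b" "x \<in> carr E" "y \<in> carr F"
  shows "lift b (tens E F x y) = b x y"
proof
  fix z
  have "bilinmap E F scalars (\<lambda>x y. b x y z)"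
    using assms(1) by (auto simp: bilinmap_def linmap_def scalars_def fscale_def)
  then show "lift b (tens E F x y) z = b x y z" by (simp add: lift_def tens_def)
qed

lemma linear_functional_separates:
  fixes s :: "'k::field \<Rightarrow> 'v::ab_group_add \<Rightarrow> 'v"
  assumes "vector_space s" and "\<And>\<phi>. Vector_Spaces.linear s (*) \<phi> \<Longrightarrow> \<phi> v = \<phi> w"
  shows "v = w"
proof (rule ccontr)
  assume ne: "v \<noteq> w"
  interpret P: vector_space_pair s "(*) :: 'k \<Rightarrow> 'k \<Rightarrow> 'k"
    using assms(1) by (auto simp: vector_space_pair_def vector_space_def algebra_simps)
  have "P.vs1.independent {v - w}" using ne by (simp add: P.vs1.dependent_single)
  from P.linear_independent_extend[OF this, of "\<lambda>_. 1"]
  obtain \<phi> where "Vector_Spaces.linear s (*) \<phi>" "\<phi> (v - w) = 1" by auto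
  then show False using assms(2)[of \<phi>] P.linear_diff[of \<phi> v w] by simp
qed

lemma bilinmap_cong:
  assumes E: "is_vspace E" and F: "is_vspace F"
    and b: "bilinmap E F G b" and eq: "\<And>x y. x \<in> carr E \<Longrightarrow> y \<in> carr F \<Longrightarrow> b' x y = b x y"
  shows "bilinmap E F G b'"
proof -
  interpret E: vector_space "smul E" using E by (simp add: is_vspace_def)
  interpret F: vector_space "smul F" using F by (simp add: is_vspace_def)
  have "E.subspace (carr E)" "F.subspace (carr F)" using E F by (simp_all add: is_vspace_def)
  then show ?thesis using b eq
    by (simp add: bilinmap_def linmap_def E.subspace_def F.subspace_def)
qed

theorem tensor_universal:
  fixes E :: "('k::field, 'v::ab_group_add) vspace" and F :: "('k, 'w::ab_group_add) vspace"
    and G :: "('k, 'z::ab_group_add) vspace"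
  assumes G: "is_vspace G" and b: "bilinmap E F G b"
  shows "\<exists>L. linmap (E \<otimes> F) G L \<and> (\<forall>x\<in>carr E. \<forall>y\<in>carr F. L (tens E F x y) = b x y)"
proof -
  define T where "T = {tens E F x y | x y. x \<in> carr E \<and> y \<in> carr F}"
  interpret P: vector_space_pair "fscale :: 'k \<Rightarrow> (('v \<Rightarrow> 'w \<Rightarrow> 'k) \<Rightarrow> 'k) \<Rightarrow> _" "smul G"
    using G vector_space_fscale by (simp add: vector_space_pair_def is_vspace_def)
  have subG: "P.vs2.subspace (carr G)" using G by (simp add: is_vspace_def)
  have carrT: "carr (E \<otimes> F) = P.vs1.span T" and smulT: "smul (E \<otimes> F) = fscale"
    by (simp_all add: tensor_def T_def)
  obtain B where B: "B \<subseteq> T" "P.vs1.independent B" "T \<subseteq> P.vs1.span B"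
    using P.vs1.maximal_independent_subset by blast
  have spanB: "P.vs1.span B = P.vs1.span T"
    using B by (metis P.vs1.span_mono P.vs1.span_minimal P.vs1.subspace_span subset_antisym)
  have "\<forall>t\<in>B. \<exists>p. fst p \<in> carr E \<and> snd p \<in> carr F \<and> t = tens E F (fst p) (snd p)"
    using B(1) by (fastforce simp: T_def)
  then obtain p where p: "\<And>t. t \<in> B \<Longrightarrow>
      fst (p t) \<in> carr E \<and> snd (p t) \<in> carr F \<and> t = tens E F (fst (p t)) (snd (p t))"
    by metis
  obtain L where L: "Vector_Spaces.linear fscale (smul G) L"
      and LB: "\<And>t. t \<in> B \<Longrightarrow> L t = b (fst (p t)) (snd (p t))"
    using P.linear_independent_extend[OF B(2), of "\<lambda>t. b (fst (p t)) (snd (p t))"] by blast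
  interpret L: Vector_Spaces.linear fscale "smul G" L by (rule L)
  have Lt: "L (tens E F x y) = b x y" if xy: "x \<in> carr E" "y \<in> carr F" for x y
  proof (rule linear_functional_separates[OF P.vs2.vector_space_axioms])
    fix \<phi> :: "'z \<Rightarrow> 'k" assume phi: "Vector_Spaces.linear (smul G) (*) \<phi>"
    interpret phi: Vector_Spaces.linear "smul G" "(*)" \<phi> by (rule phi)
    define \<beta> where "\<beta> = (\<lambda>x y. \<phi> (b x y))"
    have beta: "bilinmap E F scalars \<beta>"
      using b by (auto simp: bilinmap_def linmap_def scalars_def \<beta>_def phi.add phi.scale)
    interpret Q: vector_space_pair "fscale :: 'k \<Rightarrow> (('v \<Rightarrow> 'w \<Rightarrow> 'k) \<Rightarrow> 'k) \<Rightarrow> _"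
        "(*) :: 'k \<Rightarrow> 'k \<Rightarrow> 'k"
      using P.vs1.vector_space_axioms phi.vs2.vector_space_axioms
      by (simp add: vector_space_pair_def)
    have l1: "Vector_Spaces.linear fscale (*) (\<lambda>t. \<phi> (L t))"
      using P.vs1.vector_space_axioms phi.vs2.vector_space_axioms
      by (simp add: Vector_Spaces.linear_iff L.add L.scale phi.add phi.scale)
    have l2: "Vector_Spaces.linear fscale (*) (\<lambda>t. t \<beta> :: 'k)"
      using P.vs1.vector_space_axioms phi.vs2.vector_space_axioms
      by (simp add: Vector_Spaces.linear_iff fscale_def)
    have "\<phi> (L t) = t \<beta>" if t: "t \<in> B" for t
    proof -
      have "t \<beta> = tens E F (fst (p t)) (snd (p t)) \<beta>" using p[OF t] by simp
      then show ?thesis using LB[OF t] beta by (simp add: tens_def \<beta>_def)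
    qed
    moreover have "tens E F x y \<in> P.vs1.span B" using B(3) xy by (auto simp: T_def)
    ultimately have "\<phi> (L (tens E F x y)) = tens E F x y \<beta>"
      using Q.linear_eq_on[OF l1 l2] by blast
    then show "\<phi> (L (tens E F x y)) = \<phi> (b x y)" using beta by (simp add: tens_def \<beta>_def)
  qed
  have "L ` P.vs1.span T = P.vs2.span (L ` T)" by (rule L.span_image[symmetric])
  also have "\<dots> \<subseteq> carr G"
    using b by (intro P.vs2.span_minimal subG) (auto simp: T_def Lt bilinmap_def linmap_def)
  finally have "linmap (E \<otimes> F) G L"
    by (auto simp: linmap_def carrT smulT L.add L.scale)
  then show "\<exists>L. linmap (E \<otimes> F) G L \<and> (\<forall>x\<in>carr E. \<forall>y\<in>carr F. L (tens E F x y) = b x y)"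
    using Lt by blast
qed

theorem tensor_map_unique:
  fixes E :: "('k::field, 'v::ab_group_add) vspace" and F :: "('k, 'w::ab_group_add) vspace"
    and G :: "('k, 'z::ab_group_add) vspace"
  assumes G: "is_vspace G" and L: "linmap (E \<otimes> F) G L" and L': "linmap (E \<otimes> F) G L'"
    and eq: "\<And>x y. x \<in> carr E \<Longrightarrow> y \<in> carr F \<Longrightarrow> L (tens E F x y) = L' (tens E F x y)"
    and t: "t \<in> carr (E \<otimes> F)"
  shows "L t = L' t"
proof -
  define T where "T = {tens E F x y | x y. x \<in> carr E \<and> y \<in> carr F}"
  interpret P: vector_space_pair "fscale :: 'k \<Rightarrow> (('v \<Rightarrow> 'w \<Rightarrow> 'k) \<Rightarrow> 'k) \<Rightarrow> _" "smul G"
    using G vector_space_fscale by (simp add: vector_space_pair_def is_vspace_def)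
  have carrT: "carr (E \<otimes> F) = P.vs1.span T" and smulT: "smul (E \<otimes> F) = fscale"
    by (simp_all add: tensor_def T_def)
  have "t \<in> P.vs1.span T" using t carrT by simp
  then have "t \<in> P.vs1.span T \<and> L t = L' t"
  proof (induction rule: P.vs1.span_induct_alt)
    case base
    have "L (fscale 0 0) = smul G 0 (L 0)" "L' (fscale 0 0) = smul G 0 (L' 0)"
      using L L' P.vs1.span_zero[of T] unfolding linmap_def carrT smulT by metis+
    then show ?case
      using P.vs1.span_zero by (metis P.vs1.scale_zero_left P.vs2.scale_zero_left)
  next
    case (step c x y)
    have x: "x \<in> P.vs1.span T" using step.hyps by (rule P.vs1.span_base)
    have cx: "fscale c x \<in> P.vs1.span T" using x by (rule P.vs1.span_scale)
    have y: "y \<in> P.vs1.span T" and Ly: "L y = L' y" using step.IH by auto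
    have Lx: "L x = L' x" using eq step.hyps by (auto simp: T_def)
    have lin: "M (fscale c x + y) = smul G c (M x) + M y" if "linmap (E \<otimes> F) G M" for M
      using that x cx y unfolding linmap_def carrT smulT by metis
    show ?case
      using P.vs1.span_add[OF cx y] lin[OF L] lin[OF L'] Lx Ly by metis
  qed
  then show ?thesis by simp
qed

subsection \<open>Tensor products of maps and associativity\<close>

text \<open>\<open>tmap E' F' f g\<close> is \<open>f \<otimes> g\<close> with values in \<open>E' \<otimes> F'\<close>.\<close>

definition tmap ::
    "('k::field, 'v'::ab_group_add) vspace \<Rightarrow> ('k, 'w'::ab_group_add) vspace \<Rightarrow>
     ('v \<Rightarrow> 'v') \<Rightarrow> ('w \<Rightarrow> 'w') \<Rightarrow>
     (('v \<Rightarrow> 'w \<Rightarrow> 'k) \<Rightarrow> 'k) \<Rightarrow> (('v' \<Rightarrow> 'w' \<Rightarrow> 'k) \<Rightarrow> 'k)" where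
  "tmap E' F' f g = lift (\<lambda>x y. tens E' F' (f x) (g y))"

text \<open>\<open>(x \<otimes> y) \<otimes> z \<mapsto> x \<otimes> (y \<otimes> z)\<close> and \<open>x \<otimes> (y \<otimes> z) \<mapsto> (x \<otimes> y) \<otimes> z\<close>\<close>

definition assoc_right ::
    "('k::field, 'u::ab_group_add) vspace \<Rightarrow> ('k, 'v::ab_group_add) vspace \<Rightarrow>
     ('k, 'w::ab_group_add) vspace \<Rightarrow>
     (((('u \<Rightarrow> 'v \<Rightarrow> 'k) \<Rightarrow> 'k) \<Rightarrow> 'w \<Rightarrow> 'k) \<Rightarrow> 'k) \<Rightarrow>
     (('u \<Rightarrow> (('v \<Rightarrow> 'w \<Rightarrow> 'k) \<Rightarrow> 'k) \<Rightarrow> 'k) \<Rightarrow> 'k)" where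
  "assoc_right E F G = lift (\<lambda>s z. lift (\<lambda>x y. tens E (F \<otimes> G) x (tens F G y z)) s)"

definition assoc_left ::
    "('k::field, 'u::ab_group_add) vspace \<Rightarrow> ('k, 'v::ab_group_add) vspace \<Rightarrow>
     ('k, 'w::ab_group_add) vspace \<Rightarrow>
     (('u \<Rightarrow> (('v \<Rightarrow> 'w \<Rightarrow> 'k) \<Rightarrow> 'k) \<Rightarrow> 'k) \<Rightarrow> 'k) \<Rightarrow>
     (((('u \<Rightarrow> 'v \<Rightarrow> 'k) \<Rightarrow> 'k) \<Rightarrow> 'w \<Rightarrow> 'k) \<Rightarrow> 'k)" where
  "assoc_left E F G = lift (\<lambda>x s. lift (\<lambda>y z. tens (E \<otimes> F) G (tens E F x y) z) s)"

text \<open>For \<open>\<psi> : E \<otimes> F \<rightarrow> F \<otimes> E\<close>, \<open>braid12 E F G \<psi>\<close> is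
  \<open>\<psi> \<otimes> id : (E \<otimes> F) \<otimes> G \<rightarrow> (F \<otimes> E) \<otimes> G\<close>; for \<open>\<psi> : F \<otimes> G \<rightarrow> G \<otimes> F\<close>, \<open>braid23 E F G \<psi>\<close> is
  \<open>id \<otimes> \<psi> : (E \<otimes> F) \<otimes> G \<rightarrow> (E \<otimes> G) \<otimes> F\<close>. Threefold products are bracketed to the left.\<close>

definition braid12 where
  "braid12 E F G \<psi> = tmap (F \<otimes> E) G \<psi> (\<lambda>z. z)"

definition braid23 where
  "braid23 E F G \<psi> = assoc_left E G F \<circ> tmap E (G \<otimes> F) (\<lambda>x. x) \<psi> \<circ> assoc_right E F G"

section \<open>Braided vector spaces\<close>

definition lin_iso where
  "lin_iso E F f \<longleftrightarrow> linmap E F f \<and> bij_betw f (carr E) (carr F)"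

definition braided where
  "braided H \<Psi>HH \<longleftrightarrow> is_vspace H \<and> lin_iso (H \<otimes> H) (H \<otimes> H) \<Psi>HH \<and>
     (\<forall>t\<in>carr (H \<otimes> H \<otimes> H).
        braid12 H H H \<Psi>HH (braid23 H H H \<Psi>HH (braid12 H H H \<Psi>HH t)) =
        braid23 H H H \<Psi>HH (braid12 H H H \<Psi>HH (braid23 H H H \<Psi>HH t)))"

definition left_braided where
  "left_braided H \<Psi>HH V \<Psi>HV \<longleftrightarrow> is_vspace V \<and> lin_iso (H \<otimes> V) (V \<otimes> H) \<Psi>HV \<and>
     (\<forall>t\<in>carr (H \<otimes> H \<otimes> V).
        braid12 H V H \<Psi>HV (braid23 H H V \<Psi>HV (braid12 H H V \<Psi>HH t)) =
        braid23 V H H \<Psi>HH (braid12 H V H \<Psi>HV (braid23 H H V \<Psi>HV t)))"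

definition right_braided where
  "right_braided H \<Psi>HH V \<Psi>VH \<longleftrightarrow> is_vspace V \<and> lin_iso (V \<otimes> H) (H \<otimes> V) \<Psi>VH \<and>
     (\<forall>t\<in>carr (V \<otimes> H \<otimes> H).
        braid23 H V H \<Psi>VH (braid12 V H H \<Psi>VH (braid23 V H H \<Psi>HH t)) =
        braid12 H H V \<Psi>HH (braid23 H V H \<Psi>VH (braid12 V H H \<Psi>VH t)))"

definition inv_map where
  "inv_map E f = inv_into (carr E) f"

section \<open>Pairings and maps into duals of tensor products\<close>

text \<open>The two readings \<open>\<langle>f, a\<rangle>\<close> and \<open>\<langle>a, f\<rangle>\<close> of \<open>f(a)\<close>.\<close>

definition ev :: "('v \<Rightarrow> 'k) \<Rightarrow> 'v \<Rightarrow> 'k" where "ev f a = f a"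
definition ve :: "'v \<Rightarrow> ('v \<Rightarrow> 'k) \<Rightarrow> 'k" where "ve a f = f a"

text \<open>\<open>\<langle>\<langle>\<xi> \<otimes> \<eta>, x \<otimes> y\<rangle>\<rangle> = \<langle>\<xi>, y\<rangle> \<langle>\<eta>, x\<rangle>\<close>, where \<open>p\<close> is the pairing of \<open>\<xi>\<close> with \<open>y\<close> and \<open>q\<close> that
  of \<open>\<eta>\<close> with \<open>x\<close>.\<close>

definition pair2 ::
    "('a \<Rightarrow> 'y \<Rightarrow> 'k::field) \<Rightarrow> ('b \<Rightarrow> 'x \<Rightarrow> 'k) \<Rightarrow>
     (('a \<Rightarrow> 'b \<Rightarrow> 'k) \<Rightarrow> 'k) \<Rightarrow> (('x \<Rightarrow> 'y \<Rightarrow> 'k) \<Rightarrow> 'k) \<Rightarrow> 'k" where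
  "pair2 p q s t = s (\<lambda>\<xi> \<eta>. t (\<lambda>x y. p \<xi> y * q \<eta> x))"

text \<open>The linear map into \<open>(C \<otimes> D)'\<close> with \<open>(\<xi> \<otimes> \<eta>)(x \<otimes> y) = m \<xi> \<eta> x y\<close>, for \<open>m\<close> linear in each
  argument.\<close>

definition dual_map ::
    "('k::field, 'c::ab_group_add) vspace \<Rightarrow> ('k, 'd::ab_group_add) vspace \<Rightarrow>
     ('a \<Rightarrow> 'b \<Rightarrow> 'c \<Rightarrow> 'd \<Rightarrow> 'k) \<Rightarrow>
     (('a \<Rightarrow> 'b \<Rightarrow> 'k) \<Rightarrow> 'k) \<Rightarrow> (('c \<Rightarrow> 'd \<Rightarrow> 'k) \<Rightarrow> 'k) \<Rightarrow> 'k" where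
  "dual_map C D m t =
     (\<lambda>s. if s \<in> carr (C \<otimes> D) then s (\<lambda>x y. t (\<lambda>\<xi> \<eta>. m \<xi> \<eta> x y)) else 0)"

lemma dual_map_tens:
  assumes C: "is_vspace C" and D: "is_vspace D"
    and m1: "\<And>x y. x \<in> carr C \<Longrightarrow> y \<in> carr D \<Longrightarrow> bilinmap A B scalars (\<lambda>\<xi> \<eta>. m \<xi> \<eta> x y)"
    and m2: "bilinmap C D scalars (m \<xi> \<eta>)"
    and "x \<in> carr C" "y \<in> carr D"
  shows "dual_map C D m (tens A B \<xi> \<eta>) (tens C D x y) = m \<xi> \<eta> x y"
proof -
  have eq: "tens A B \<xi> \<eta> (\<lambda>\<xi> \<eta>. m \<xi> \<eta> x y) = m \<xi> \<eta> x y" if "x \<in> carr C" "y \<in> carr D" for x y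
    using m1[OF that] by (simp add: tens_def)
  have "bilinmap C D scalars (\<lambda>x y. tens A B \<xi> \<eta> (\<lambda>\<xi> \<eta>. m \<xi> \<eta> x y))"
    by (rule bilinmap_cong[OF C D m2]) (rule eq)
  then have "tens C D x y (\<lambda>x y. tens A B \<xi> \<eta> (\<lambda>\<xi> \<eta>. m \<xi> \<eta> x y)) = m \<xi> \<eta> x y"
    using eq[OF assms(5,6)] by (simp add: tens_def[of C D])
  then show ?thesis using tens_in_tensor[OF assms(5,6)] by (simp add: dual_map_def)
qed

text \<open>The embedding \<open>(\<xi> \<otimes> \<eta>)(x \<otimes> y) = \<langle>\<xi>, x\<rangle> \<langle>\<eta>, y\<rangle>\<close> of a tensor product into \<open>(C \<otimes> D)'\<close>.\<close>

definition emb where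
  "emb p q C D = dual_map C D (\<lambda>\<xi> \<eta> x y. p \<xi> x * q \<eta> y)"

text \<open>A map \<open>\<psi>\<close> from \<open>X \<otimes> Y\<close> to a dual space is a bijection \<open>X \<otimes> Y \<rightarrow> Y \<otimes> X\<close>, where \<open>\<iota>\<close> embeds
  \<open>Y \<otimes> X\<close> into that dual space. In this case \<open>to_tensor X Y \<iota> \<psi>\<close> is \<open>\<psi>\<close> as a map into \<open>Y \<otimes> X\<close>.\<close>

definition bij_flip where
  "bij_flip X Y \<iota> \<psi> \<longleftrightarrow> bij_betw \<psi> (carr (X \<otimes> Y)) (\<iota> ` carr (Y \<otimes> X))"

definition to_tensor where
  "to_tensor X Y \<iota> \<psi> t = inv_into (carr (Y \<otimes> X)) \<iota> (\<psi> t)"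

section \<open>The induced maps\<close>

definition psi_UU where
  "psi_UU H U \<Psi>HH =
     dual_map H H (\<lambda>f g b a. pair2 ev ev (tens U U f g) (\<Psi>HH (tens H H a b)))"

definition bij_UU where
  "bij_UU H U \<Psi>HH \<longleftrightarrow> bij_flip U U (emb ev ev H H) (psi_UU H U \<Psi>HH)"

text \<open>In the following two maps \<open>\<Phi> : H \<otimes> V \<rightarrow> V \<otimes> H\<close> is \<open>\<Psi>\<^sub>H\<^sub>V\<close> for a left braiding; taking the
  inverse of \<open>\<Psi>\<^sub>V\<^sub>H\<close> instead gives the maps marked with a circle for a right braiding.\<close>

definition psi_WH where
  "psi_WH H V W \<Phi> = dual_map (dual H) V
     (\<lambda>e a f v. pair2 ev ev (tens (dual H) W f e) (\<Phi> (tens H V a v)))"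

definition psi_VU where
  "psi_VU H V U \<Phi> = dual_map H (dual V)
     (\<lambda>v f a e. pair2 ev ev (tens U (dual V) f e) (\<Phi> (tens H V a v)))"

text \<open>In the following two maps \<open>\<Phi> : V \<otimes> H \<rightarrow> H \<otimes> V\<close> is \<open>\<Psi>\<^sub>V\<^sub>H\<close> for a right braiding; taking the
  inverse of \<open>\<Psi>\<^sub>H\<^sub>V\<close> instead gives the maps marked with a circle for a left braiding.\<close>

definition psi_HW where
  "psi_HW H V W \<Phi> = dual_map V (dual H)
     (\<lambda>a e v f. pair2 ev ev (tens W (dual H) e f) (\<Phi> (tens V H v a)))"

definition psi_UV where
  "psi_UV H V U \<Phi> = dual_map (dual V) H
     (\<lambda>f v e a. pair2 ev ev (tens (dual V) U e f) (\<Phi> (tens V H v a)))"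

definition emb_HW where "emb_HW H V = emb ve ev (dual H) V"
definition emb_UV where "emb_UV H V = emb ev ve H (dual V)"
definition emb_WH where "emb_WH H V = emb ev ve V (dual H)"
definition emb_VU where "emb_VU H V = emb ve ev (dual V) H"

definition bij_WH where
  "bij_WH H V W \<Phi> \<longleftrightarrow> bij_flip W H (emb_HW H V) (psi_WH H V W \<Phi>)"
definition bij_VU where
  "bij_VU H V U \<Phi> \<longleftrightarrow> bij_flip V U (emb_UV H V) (psi_VU H V U \<Phi>)"
definition bij_HW where
  "bij_HW H V W \<Phi> \<longleftrightarrow> bij_flip H W (emb_WH H V) (psi_HW H V W \<Phi>)"
definition bij_UV where
  "bij_UV H V U \<Phi> \<longleftrightarrow> bij_flip U V (emb_VU H V) (psi_UV H V U \<Phi>)"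

text \<open>The two maps \<open>U \<otimes> W \<rightarrow> (V \<otimes> H)'\<close> obtained from \<open>psi_WH\<close> and \<open>psi_VU\<close>\<close>

definition psi_UW_via_WH where
  "psi_UW_via_WH H V U W \<Phi> = dual_map V H
     (\<lambda>f e v a. pair2 ve ev (tens V U v f)
                  (to_tensor W H (emb_HW H V) (psi_WH H V W \<Phi>) (tens W H e a)))"

definition psi_UW_via_VU where
  "psi_UW_via_VU H V U W \<Phi> = dual_map V H
     (\<lambda>f e v a. pair2 ev ve (tens W H e a)
                  (to_tensor V U (emb_UV H V) (psi_VU H V U \<Phi>) (tens V U v f)))"

text \<open>The two maps \<open>W \<otimes> U \<rightarrow> (H \<otimes> V)'\<close> obtained from \<open>psi_UV\<close> and \<open>psi_HW\<close>\<close>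

definition psi_WU_via_UV where
  "psi_WU_via_UV H V U W \<Phi> = dual_map H V
     (\<lambda>e f a v. pair2 ve ev (tens H W a e)
                  (to_tensor U V (emb_VU H V) (psi_UV H V U \<Phi>) (tens U V f v)))"

definition psi_WU_via_HW where
  "psi_WU_via_HW H V U W \<Phi> = dual_map H V
     (\<lambda>e f a v. pair2 ev ve (tens U V f v)
                  (to_tensor H W (emb_WH H V) (psi_HW H V W \<Phi>) (tens H W a e)))"

definition bij_UW where
  "bij_UW H V U W \<psi> \<longleftrightarrow> bij_flip U W (emb ev ev V H) \<psi>"
definition bij_WU where
  "bij_WU H V U W \<psi> \<longleftrightarrow> bij_flip W U (emb ev ev H V) \<psi>"

end

theory Submission
  imports Defs
begin

text \<open>The two maps \<open>U \<otimes> W \<rightarrow> (V \<otimes> H)'\<close> obtained from a linear map \<open>\<Phi> : H \<otimes> V \<rightarrow> V \<otimes> H\<close>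
  have the same matrix coefficients. The maps \<open>\<Psi>\<^sub>W\<^sub>H\<close> and \<open>\<Psi>\<^sub>V\<^sub>U\<close> are the partial transposes of \<open>\<Phi>\<close>: in the first
  one the leg \<open>V\<close> is dualised, in the second one the leg \<open>H\<close>. Bijectivity of \<open>\<Psi>\<^sub>W\<^sub>H\<close> ensures that
  its values come from \<open>H \<otimes> W\<close>, hence that the remaining leg \<open>H\<close> can be dualised as well, and likewise for
  \<open>\<Psi>\<^sub>V\<^sub>U\<close> and \<open>U \<otimes> V\<close>. Either way the result is the full transpose of \<open>\<Phi>\<close>,
  whose value at \<open>f \<otimes> e\<close> sends \<open>v \<otimes> a\<close> to \<open>(e \<otimes> f)(\<Phi>(a \<otimes> v))\<close>,
  so the two maps agree (\<open>psi_UW_via_WH_eq_via_VU\<close>), and one is a bijection onto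
  \<open>W \<otimes> U\<close> exactly when the other is.

  The four claims are instances of this one fact, with \<open>\<Phi>\<close> being \<open>\<Psi>\<^sub>H\<^sub>V\<close>, its
  inverse, \<open>\<Psi>\<^sub>V\<^sub>H\<close> or its inverse. If \<open>\<Phi>\<close> is defined on \<open>V \<otimes> H\<close>, the definitions turn into
  those for a map on \<open>H \<otimes> V\<close> when the pair \<open>(H, U)\<close> is exchanged with \<open>(V, W)\<close>
  (\<open>psi_WU_via_UV_swap\<close>, \<open>psi_WU_via_HW_swap\<close>).

  The remaining work is to read off such coefficients. A tensor is itself a function on forms, and
  it acts linearly only on forms that are bilinear on the carriers; so each evaluation of a pairing
  rests on the bilinearity of the forms involved (\<open>pair2_tens\<close>, \<open>emb_tens\<close>).\<close>

section \<open>Linear maps on carriers and subspaces of the dual\<close>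

lemma is_vspace_closed:
  assumes "is_vspace E"
  shows "0 \<in> carr E" "x \<in> carr E \<Longrightarrow> y \<in> carr E \<Longrightarrow> x + y \<in> carr E"
    "x \<in> carr E \<Longrightarrow> smul E c x \<in> carr E"
proof -
  interpret vector_space "smul E" using assms by (simp add: is_vspace_def)
  have "subspace (carr E)" using assms by (simp add: is_vspace_def)
  then show "0 \<in> carr E" "x \<in> carr E \<Longrightarrow> y \<in> carr E \<Longrightarrow> x + y \<in> carr E"
    "x \<in> carr E \<Longrightarrow> smul E c x \<in> carr E"
    by (auto simp: subspace_def)
qed

lemma linmap_cong:
  assumes "is_vspace E" and "\<And>x. x \<in> carr E \<Longrightarrow> g x = f x"
  shows "linmap E F g \<longleftrightarrow> linmap E F f"
  using assms is_vspace_closed[OF assms(1)] by (simp add: linmap_def)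

lemma bilinmap_cong_iff:
  assumes "is_vspace E" "is_vspace F" and "\<And>x y. x \<in> carr E \<Longrightarrow> y \<in> carr F \<Longrightarrow> b' x y = b x y"
  shows "bilinmap E F G b' \<longleftrightarrow> bilinmap E F G b"
  using bilinmap_cong[OF assms(1,2), of G b b'] bilinmap_cong[OF assms(1,2), of G b' b] assms(3)
  by auto

lemma linmap_inv_map:
  assumes E: "is_vspace E" and iso: "lin_iso E F f"
  shows "linmap F E (inv_map E f)"
proof -
  have lin: "linmap E F f" and bij: "bij_betw f (carr E) (carr F)"
    using iso by (auto simp: lin_iso_def)
  have mem: "inv_map E f y \<in> carr E" and inv: "f (inv_map E f y) = y" if "y \<in> carr F" for y
    using bij that unfolding inv_map_def bij_betw_def
    by (auto intro: inv_into_into f_inv_into_f)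
  have inv': "inv_map E f (f x) = x" if "x \<in> carr E" for x
    using bij that by (auto simp: inv_map_def bij_betw_def)
  have "inv_map E f (x + y) = inv_map E f x + inv_map E f y" if "x \<in> carr F" "y \<in> carr F" for x y
  proof -
    have "x + y = f (inv_map E f x + inv_map E f y)"
      using lin mem inv that by (simp add: linmap_def)
    then show ?thesis using inv' is_vspace_closed(2)[OF E] mem that by metis
  qed
  moreover have "inv_map E f (smul F c x) = smul E c (inv_map E f x)" if "x \<in> carr F" for c x
  proof -
    have "smul F c x = f (smul E c (inv_map E f x))"
      using lin mem inv that by (simp add: linmap_def)
    then show ?thesis using inv' is_vspace_closed(3)[OF E] mem that by metis
  qed
  ultimately show ?thesis using mem by (auto simp: linmap_def)
qed

lemma is_vspace_dual:
  assumes "is_vspace E"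
  shows "is_vspace (dual E)"
proof -
  interpret vector_space "fscale :: 'a \<Rightarrow> ('b \<Rightarrow> 'a) \<Rightarrow> 'b \<Rightarrow> 'a" by (rule vector_space_fscale)
  show ?thesis
    using is_vspace_closed[OF assms] vector_space_axioms
    by (auto simp: is_vspace_def dual_def subspace_def linmap_def scalars_def fscale_def algebra_simps)
qed

lemma is_subspace_of_refl: "is_vspace E \<Longrightarrow> is_subspace_of E E"
  by (simp add: is_subspace_of_def)

lemma bilinmap_ev:
  assumes "is_subspace_of U (dual E)"
  shows "bilinmap U E scalars ev"
  using assms
  by (auto simp: bilinmap_def linmap_def is_subspace_of_def dual_def scalars_def fscale_def ev_def)

lemma bilinmap_ve:
  assumes "is_subspace_of U (dual E)"
  shows "bilinmap E U scalars ve"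
  using assms
  by (auto simp: bilinmap_def linmap_def is_subspace_of_def dual_def scalars_def fscale_def ve_def)

lemma bilinmap_mult:
  assumes "\<phi> \<in> carr (dual E)" "\<psi> \<in> carr (dual F)"
  shows "bilinmap E F scalars (\<lambda>x y. \<psi> y * \<phi> x)"
  using assms by (auto simp: bilinmap_def linmap_def dual_def scalars_def algebra_simps)

section \<open>Evaluating tensors at bilinear forms\<close>

lemma tensor_induct [consumes 1, case_names zero step]:
  assumes "t \<in> carr (E \<otimes> F)" and "P 0"
    and "\<And>c x y t. x \<in> carr E \<Longrightarrow> y \<in> carr F \<Longrightarrow> t \<in> carr (E \<otimes> F) \<Longrightarrow> P t \<Longrightarrow>
           P (fscale c (tens E F x y) + t)"
  shows "P t"
proof -
  interpret vector_space fscale by (rule vector_space_fscale)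
  let ?T = "{tens E F x y | x y. x \<in> carr E \<and> y \<in> carr F}"
  have "t \<in> span ?T" using assms(1) by (simp add: tensor_def)
  then have "t \<in> span ?T \<and> P t"
  proof (induction rule: span_induct_alt)
    case base
    then show ?case using assms(2) span_zero by blast
  next
    case (step c x y)
    then obtain u w where "u \<in> carr E" "w \<in> carr F" "x = tens E F u w" by auto
    moreover have "fscale c x + y \<in> span ?T"
      using step by (intro span_add span_scale) (auto intro: span_base)
    moreover have "P (fscale c x + y)"
      using assms(3)[of u w y c] step calculation by (simp add: tensor_def del: plus_fun_apply)
    ultimately show ?case by blast
  qed
  then show ?thesis by simp
qed

text \<open>Since a form that agrees with a bilinear one on the carriers is bilinear itself, a pure tensor, and
  hence every tensor, sees only the values of a form on the carriers. For a form that is not bilinear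
  this is the default value \<open>0\<close> in \<open>tens\<close>.\<close>

lemma tensor_apply_cong:
  assumes E: "is_vspace E" and F: "is_vspace F" and t: "t \<in> carr (E \<otimes> F)"
    and eq: "\<And>x y. x \<in> carr E \<Longrightarrow> y \<in> carr F \<Longrightarrow> \<beta> x y = \<gamma> x y"
  shows "t \<beta> = t \<gamma>"
  using t
proof (induction rule: tensor_induct)
  case (step c x y t)
  have "bilinmap E F scalars \<beta> \<longleftrightarrow> bilinmap E F scalars \<gamma>"
    by (rule bilinmap_cong_iff[OF E F eq])
  then show ?case using step eq by (simp add: tens_def fscale_def)
qed simp

text \<open>A tensor depends linearly on the form as long as the form stays bilinear.
  A linear family of forms is used here, rather than sums and multiples of forms,
  because all forms below come with parameters in which they are linear.\<close>

lemma linmap_tensor_apply: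
  assumes C: "is_vspace C" and t: "t \<in> carr (E \<otimes> F)"
    and bil: "\<And>p. p \<in> carr C \<Longrightarrow> bilinmap E F scalars (\<beta> p)"
    and lin: "\<And>x y. x \<in> carr E \<Longrightarrow> y \<in> carr F \<Longrightarrow> linmap C scalars (\<lambda>p. \<beta> p x y)"
  shows "linmap C scalars (\<lambda>p. t (\<beta> p))"
  using t
proof (induction rule: tensor_induct)
  case zero
  then show ?case by (simp add: linmap_def scalars_def)
next
  case (step c x y t)
  have "linmap C scalars (\<lambda>p. c * \<beta> p x y + t (\<beta> p))"
    using lin[OF step.hyps(1,2)] step.IH by (simp add: linmap_def scalars_def algebra_simps)
  moreover have "(fscale c (tens E F x y) + t) (\<beta> p) = c * \<beta> p x y + t (\<beta> p)" if "p \<in> carr C" for p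
    using bil[OF that] by (simp add: tens_def fscale_def)
  ultimately show ?case
    using linmap_cong[OF C, of "\<lambda>p. (fscale c (tens E F x y) + t) (\<beta> p)"
      "\<lambda>p. c * \<beta> p x y + t (\<beta> p)" scalars] by metis
qed

lemma smul_tensor: "smul (E \<otimes> F) = fscale"
  by (simp add: tensor_def)

lemma linmap_tens_left:
  assumes "y \<in> carr F"
  shows "linmap E (E \<otimes> F) (\<lambda>x. tens E F x y)"
proof -
  have "tens E F (x + x') y = tens E F x y + tens E F x' y" if "x \<in> carr E" "x' \<in> carr E" for x x'
    using assms that by (auto simp: tens_def fun_eq_iff bilinmap_def linmap_def)
  moreover have "tens E F (smul E c x) y = fscale c (tens E F x y)" if "x \<in> carr E" for c x
    using assms that by (auto simp: tens_def fun_eq_iff bilinmap_def linmap_def fscale_def scalars_def)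
  ultimately show ?thesis
    using tens_in_tensor[of _ E y F] assms by (simp add: linmap_def smul_tensor)
qed

lemma linmap_tens_right:
  assumes "x \<in> carr E"
  shows "linmap F (E \<otimes> F) (tens E F x)"
proof -
  have "tens E F x (y + y') = tens E F x y + tens E F x y'" if "y \<in> carr F" "y' \<in> carr F" for y y'
    using assms that by (auto simp: tens_def fun_eq_iff bilinmap_def linmap_def)
  moreover have "tens E F x (smul F c y) = fscale c (tens E F x y)" if "y \<in> carr F" for c y
    using assms that by (auto simp: tens_def fun_eq_iff bilinmap_def linmap_def fscale_def scalars_def)
  ultimately show ?thesis
    using tens_in_tensor[of x E _ F] assms by (simp add: linmap_def smul_tensor)
qed

lemma pair2_tens:
  assumes A: "is_vspace A" and B: "is_vspace B"
    and p: "bilinmap A Y scalars p" and q: "bilinmap B X scalars q"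
    and s: "s \<in> carr (X \<otimes> Y)" and xi: "\<xi> \<in> carr A" and eta: "\<eta> \<in> carr B"
  shows "pair2 p q (tens A B \<xi> \<eta>) s = s (\<lambda>x y. p \<xi> y * q \<eta> x)"
proof -
  have bil: "bilinmap X Y scalars (\<lambda>x y. p \<xi> y * q \<eta> x)" if "\<xi> \<in> carr A" "\<eta> \<in> carr B" for \<xi> \<eta>
    using p q that by (auto simp: bilinmap_def linmap_def scalars_def algebra_simps)
  have "bilinmap A B scalars (\<lambda>\<xi> \<eta>. s (\<lambda>x y. p \<xi> y * q \<eta> x))"
    unfolding bilinmap_def
  proof (intro conjI ballI)
    fix \<xi> assume xi: "\<xi> \<in> carr A"
    show "linmap B scalars (\<lambda>\<eta>. s (\<lambda>x y. p \<xi> y * q \<eta> x))"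
      using q xi by (intro linmap_tensor_apply[OF B s] bil)
        (auto simp: bilinmap_def linmap_def scalars_def algebra_simps)
  next
    fix \<eta> assume eta: "\<eta> \<in> carr B"
    show "linmap A scalars (\<lambda>\<xi>. s (\<lambda>x y. p \<xi> y * q \<eta> x))"
      using p eta by (intro linmap_tensor_apply[OF A s] bil)
        (auto simp: bilinmap_def linmap_def scalars_def algebra_simps)
  qed
  then show ?thesis unfolding pair2_def tens_def by (rule if_P)
qed

text \<open>In contrast to \<open>dual_map_tens\<close>, the embedded tensor \<open>t\<close> is arbitrary here, because
  the values of a bijective \<open>\<Psi>\<^sub>X\<^sub>Y\<close> need not be pure tensors.\<close>

lemma emb_tens:
  assumes C: "is_vspace C" and D: "is_vspace D"
    and p: "bilinmap A C scalars p" and q: "bilinmap B D scalars q"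
    and t: "t \<in> carr (A \<otimes> B)" and x: "x \<in> carr C" and y: "y \<in> carr D"
  shows "emb p q C D t (tens C D x y) = t (\<lambda>\<xi> \<eta>. p \<xi> x * q \<eta> y)"
proof -
  have bil: "bilinmap A B scalars (\<lambda>\<xi> \<eta>. p \<xi> x * q \<eta> y)" if "x \<in> carr C" "y \<in> carr D" for x y
    using p q that by (simp add: bilinmap_def linmap_def scalars_def algebra_simps)
  have "bilinmap C D scalars (\<lambda>x y. t (\<lambda>\<xi> \<eta>. p \<xi> x * q \<eta> y))"
    unfolding bilinmap_def
  proof (intro conjI ballI)
    fix x assume x: "x \<in> carr C"
    show "linmap D scalars (\<lambda>y. t (\<lambda>\<xi> \<eta>. p \<xi> x * q \<eta> y))"
      using q x by (intro linmap_tensor_apply[OF D t] bil)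
        (simp_all add: bilinmap_def linmap_def scalars_def algebra_simps)
  next
    fix y assume y: "y \<in> carr D"
    show "linmap C scalars (\<lambda>x. t (\<lambda>\<xi> \<eta>. p \<xi> x * q \<eta> y))"
      using p y by (intro linmap_tensor_apply[OF C t] bil)
        (simp_all add: bilinmap_def linmap_def scalars_def algebra_simps)
  qed
  then have "tens C D x y (\<lambda>x y. t (\<lambda>\<xi> \<eta>. p \<xi> x * q \<eta> y)) = t (\<lambda>\<xi> \<eta>. p \<xi> x * q \<eta> y)"
    unfolding tens_def by (rule if_P)
  then show ?thesis
    using tens_in_tensor[OF x y] by (simp add: emb_def dual_map_def)
qed

lemma dual_map_cong:
  assumes A: "is_vspace A" and B: "is_vspace B" and C: "is_vspace C" and D: "is_vspace D"
    and t: "t \<in> carr (A \<otimes> B)"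
    and eq: "\<And>\<xi> \<eta> x y. \<xi> \<in> carr A \<Longrightarrow> \<eta> \<in> carr B \<Longrightarrow> x \<in> carr C \<Longrightarrow> y \<in> carr D \<Longrightarrow>
               m \<xi> \<eta> x y = n \<xi> \<eta> x y"
  shows "dual_map C D m t = dual_map C D n t"
proof
  fix s
  have "t (\<lambda>\<xi> \<eta>. m \<xi> \<eta> x y) = t (\<lambda>\<xi> \<eta>. n \<xi> \<eta> x y)" if "x \<in> carr C" "y \<in> carr D" for x y
    using eq that by (intro tensor_apply_cong[OF A B t])
  then show "dual_map C D m t s = dual_map C D n t s"
    unfolding dual_map_def using tensor_apply_cong[OF C D] by simp
qed

lemma to_tensor_spec:
  assumes "bij_flip X Y \<iota> \<psi>" "t \<in> carr (X \<otimes> Y)"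
  shows "to_tensor X Y \<iota> \<psi> t \<in> carr (Y \<otimes> X)" "\<iota> (to_tensor X Y \<iota> \<psi> t) = \<psi> t"
proof -
  have "\<psi> t \<in> \<iota> ` carr (Y \<otimes> X)" using assms by (auto simp: bij_flip_def bij_betw_def)
  then show "to_tensor X Y \<iota> \<psi> t \<in> carr (Y \<otimes> X)" "\<iota> (to_tensor X Y \<iota> \<psi> t) = \<psi> t"
    unfolding to_tensor_def by (simp_all add: inv_into_into f_inv_into_f)
qed

section \<open>Matrix coefficients and partial transposes\<close>

text \<open>This is \<open>(e \<otimes> f)(\<Phi>(a \<otimes> v))\<close>: the tensor \<open>\<Phi>(a \<otimes> v) \<in> V \<otimes> H\<close> is evaluated at the
  product of the linear forms \<open>e\<close> and \<open>f\<close>.\<close>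

definition matrix_coeff ::
    "('k::field, 'h::ab_group_add) vspace \<Rightarrow> ('k, 'v::ab_group_add) vspace \<Rightarrow>
     ((('h \<Rightarrow> 'v \<Rightarrow> 'k) \<Rightarrow> 'k) \<Rightarrow> (('v \<Rightarrow> 'h \<Rightarrow> 'k) \<Rightarrow> 'k)) \<Rightarrow>
     ('h \<Rightarrow> 'k) \<Rightarrow> ('v \<Rightarrow> 'k) \<Rightarrow> 'h \<Rightarrow> 'v \<Rightarrow> 'k" where
  "matrix_coeff H V \<Phi> f e a v = \<Phi> (tens H V a v) (\<lambda>x y. f y * e x)"

context
  fixes H :: "('k::field, 'h::ab_group_add) vspace" and V :: "('k, 'v::ab_group_add) vspace"
    and \<Phi> :: "(('h \<Rightarrow> 'v \<Rightarrow> 'k) \<Rightarrow> 'k) \<Rightarrow> (('v \<Rightarrow> 'h \<Rightarrow> 'k) \<Rightarrow> 'k)"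
  assumes H: "is_vspace H" and V: "is_vspace V" and lin: "linmap (H \<otimes> V) (V \<otimes> H) \<Phi>"
begin

lemma Phi_tens_mem: "a \<in> carr H \<Longrightarrow> v \<in> carr V \<Longrightarrow> \<Phi> (tens H V a v) \<in> carr (V \<otimes> H)"
  using lin tens_in_tensor[of a H v V] by (simp add: linmap_def)

lemma linmap_matrix_coeff_H:
  assumes v: "v \<in> carr V"
  shows "linmap H scalars (\<lambda>a. matrix_coeff H V \<Phi> f e a v)"
  using linmap_tens_left[OF v, of H] lin
  by (simp add: linmap_def matrix_coeff_def scalars_def smul_tensor fscale_def)

lemma linmap_matrix_coeff_V:
  assumes a: "a \<in> carr H"
  shows "linmap V scalars (\<lambda>v. matrix_coeff H V \<Phi> f e a v)"
  using linmap_tens_right[OF a, of V] lin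
  by (simp add: linmap_def matrix_coeff_def scalars_def smul_tensor fscale_def)

lemma linmap_matrix_coeff_U:
  assumes U: "is_subspace_of U (dual H)"
    and "e \<in> carr (dual V)" "a \<in> carr H" "v \<in> carr V"
  shows "linmap U scalars (\<lambda>f. matrix_coeff H V \<Phi> f e a v)"
proof -
  have vU: "is_vspace U" and smul: "smul U = fscale" and sub: "carr U \<subseteq> carr (dual H)"
    using U by (simp_all add: is_subspace_of_def dual_def)
  show ?thesis unfolding matrix_coeff_def
  proof (rule linmap_tensor_apply[OF vU Phi_tens_mem[OF assms(3,4)]])
    show "bilinmap V H scalars (\<lambda>x y. f y * e x)" if "f \<in> carr U" for f
      using that assms(2) sub by (intro bilinmap_mult) auto
    show "linmap U scalars (\<lambda>f. f y * e x)" for x y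
      by (simp add: linmap_def scalars_def smul fscale_def algebra_simps)
  qed
qed

lemma linmap_matrix_coeff_W:
  assumes W: "is_subspace_of W (dual V)"
    and "f \<in> carr (dual H)" "a \<in> carr H" "v \<in> carr V"
  shows "linmap W scalars (\<lambda>e. matrix_coeff H V \<Phi> f e a v)"
proof -
  have vW: "is_vspace W" and smul: "smul W = fscale" and sub: "carr W \<subseteq> carr (dual V)"
    using W by (simp_all add: is_subspace_of_def dual_def)
  show ?thesis unfolding matrix_coeff_def
  proof (rule linmap_tensor_apply[OF vW Phi_tens_mem[OF assms(3,4)]])
    show "bilinmap V H scalars (\<lambda>x y. f y * e x)" if "e \<in> carr W" for e
      using that assms(2) sub by (intro bilinmap_mult) auto
    show "linmap W scalars (\<lambda>e. f y * e x)" for x y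
      by (simp add: linmap_def scalars_def smul fscale_def algebra_simps)
  qed
qed

lemma pair2_Phi:
  assumes U: "is_subspace_of U (dual H)" and W: "is_subspace_of W (dual V)"
    and "f \<in> carr U" "e \<in> carr W" "a \<in> carr H" "v \<in> carr V"
  shows "pair2 ev ev (tens U W f e) (\<Phi> (tens H V a v)) = matrix_coeff H V \<Phi> f e a v"
proof -
  have "is_vspace U" "is_vspace W" using U W by (auto simp: is_subspace_of_def)
  from pair2_tens[OF this bilinmap_ev[OF U] bilinmap_ev[OF W]] show ?thesis
    using assms Phi_tens_mem by (simp add: matrix_coeff_def ev_def)
qed

text \<open>The coefficient is linear in each of its four arguments, and on the carriers it equals the
  expression that defines \<open>\<Psi>\<^sub>W\<^sub>H\<close> (respectively \<open>\<Psi>\<^sub>V\<^sub>U\<close>). That expression is therefore bilinear in both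
  pairs of arguments, which makes the induced map take the expected value on pure tensors.\<close>

lemma psi_WH_tens:
  assumes W: "is_subspace_of W (dual V)"
    and e: "e \<in> carr W" and a: "a \<in> carr H" and f: "f \<in> carr (dual H)" and v: "v \<in> carr V"
  shows "psi_WH H V W \<Phi> (tens W H e a) (tens (dual H) V f v) = matrix_coeff H V \<Phi> f e a v"
proof -
  note dH = is_subspace_of_refl[OF is_vspace_dual[OF H]]
  have vW: "is_vspace W" and subW: "\<And>e. e \<in> carr W \<Longrightarrow> e \<in> carr (dual V)"
    using W by (auto simp: is_subspace_of_def)
  note eval = pair2_Phi[OF dH W]
  have m1: "bilinmap W H scalars (\<lambda>e a. pair2 ev ev (tens (dual H) W f e) (\<Phi> (tens H V a v)))"
    if "f \<in> carr (dual H)" "v \<in> carr V" for f v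
  proof (rule bilinmap_cong[OF vW H])
    show "bilinmap W H scalars (\<lambda>e a. matrix_coeff H V \<Phi> f e a v)"
      using that linmap_matrix_coeff_H linmap_matrix_coeff_W[OF W] by (auto simp: bilinmap_def)
  qed (use eval that in auto)
  have m2: "bilinmap (dual H) V scalars
      (\<lambda>f v. pair2 ev ev (tens (dual H) W f e) (\<Phi> (tens H V a v)))"
  proof (rule bilinmap_cong[OF is_vspace_dual[OF H] V])
    show "bilinmap (dual H) V scalars (\<lambda>f v. matrix_coeff H V \<Phi> f e a v)"
      using e a subW linmap_matrix_coeff_V linmap_matrix_coeff_U[OF dH] by (auto simp: bilinmap_def)
  qed (use eval e a in auto)
  have "psi_WH H V W \<Phi> (tens W H e a) (tens (dual H) V f v) =
      pair2 ev ev (tens (dual H) W f e) (\<Phi> (tens H V a v))"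
    unfolding psi_WH_def
    by (rule dual_map_tens[OF is_vspace_dual[OF H] V]) (simp_all add: m1 m2 f v)
  then show ?thesis using eval[OF f e a v] by simp
qed

lemma psi_VU_tens:
  assumes U: "is_subspace_of U (dual H)"
    and v: "v \<in> carr V" and f: "f \<in> carr U" and a: "a \<in> carr H" and e: "e \<in> carr (dual V)"
  shows "psi_VU H V U \<Phi> (tens V U v f) (tens H (dual V) a e) = matrix_coeff H V \<Phi> f e a v"
proof -
  note dV = is_subspace_of_refl[OF is_vspace_dual[OF V]]
  have vU: "is_vspace U" and subU: "\<And>f. f \<in> carr U \<Longrightarrow> f \<in> carr (dual H)"
    using U by (auto simp: is_subspace_of_def)
  note eval = pair2_Phi[OF U dV]
  have m1: "bilinmap V U scalars (\<lambda>v f. pair2 ev ev (tens U (dual V) f e) (\<Phi> (tens H V a v)))"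
    if "a \<in> carr H" "e \<in> carr (dual V)" for a e
  proof (rule bilinmap_cong[OF V vU])
    show "bilinmap V U scalars (\<lambda>v f. matrix_coeff H V \<Phi> f e a v)"
      using that linmap_matrix_coeff_V linmap_matrix_coeff_U[OF U] by (auto simp: bilinmap_def)
  qed (use eval that in auto)
  have m2: "bilinmap H (dual V) scalars
      (\<lambda>a e. pair2 ev ev (tens U (dual V) f e) (\<Phi> (tens H V a v)))"
  proof (rule bilinmap_cong[OF H is_vspace_dual[OF V]])
    show "bilinmap H (dual V) scalars (\<lambda>a e. matrix_coeff H V \<Phi> f e a v)"
      using v f subU linmap_matrix_coeff_H linmap_matrix_coeff_W[OF dV] by (auto simp: bilinmap_def)
  qed (use eval v f in auto)
  have "psi_VU H V U \<Phi> (tens V U v f) (tens H (dual V) a e) =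
      pair2 ev ev (tens U (dual V) f e) (\<Phi> (tens H V a v))"
    unfolding psi_VU_def
    by (rule dual_map_tens[OF H is_vspace_dual[OF V]]) (simp_all add: m1 m2 a e)
  then show ?thesis using eval[OF f e a v] by simp
qed

section \<open>The two iterated transposes agree\<close>

text \<open>Pairing \<open>\<Psi>\<^sub>W\<^sub>H(e \<otimes> a) \<in> H \<otimes> W\<close> with \<open>v\<close> and \<open>f\<close> is the same as evaluating its image
  in \<open>(H' \<otimes> V)'\<close> at \<open>f \<otimes> v\<close>.\<close>

lemma pair2_psi_WH:
  assumes U: "is_subspace_of U (dual H)" and W: "is_subspace_of W (dual V)"
    and bij: "bij_WH H V W \<Phi>"
    and f: "f \<in> carr U" and e: "e \<in> carr W" and v: "v \<in> carr V" and a: "a \<in> carr H"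
  shows "pair2 ve ev (tens V U v f)
           (to_tensor W H (emb_HW H V) (psi_WH H V W \<Phi>) (tens W H e a)) =
         matrix_coeff H V \<Phi> f e a v"
proof -
  define t where "t = to_tensor W H (emb_HW H V) (psi_WH H V W \<Phi>) (tens W H e a)"
  have t: "t \<in> carr (H \<otimes> W)" "emb_HW H V t = psi_WH H V W \<Phi> (tens W H e a)"
    using to_tensor_spec bij tens_in_tensor[OF e a] unfolding t_def bij_WH_def by blast+
  have fH: "f \<in> carr (dual H)" and "is_vspace U" using U f by (auto simp: is_subspace_of_def)
  note dH = is_subspace_of_refl[OF is_vspace_dual[OF H]]
  have "pair2 ve ev (tens V U v f) t = t (\<lambda>x y. ve v y * ev f x)"
    by (rule pair2_tens[OF V \<open>is_vspace U\<close> bilinmap_ve[OF W] bilinmap_ev[OF U] t(1) v f])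
  also have "\<dots> = emb_HW H V t (tens (dual H) V f v)"
    unfolding emb_HW_def
    by (simp add: emb_tens[OF is_vspace_dual[OF H] V bilinmap_ve[OF dH] bilinmap_ev[OF W] t(1) fH v]
        ev_def ve_def mult.commute)
  also have "\<dots> = matrix_coeff H V \<Phi> f e a v"
    using t(2) psi_WH_tens[OF W e a fH v] by simp
  finally show ?thesis by (simp add: t_def)
qed

lemma pair2_psi_VU:
  assumes U: "is_subspace_of U (dual H)" and W: "is_subspace_of W (dual V)"
    and bij: "bij_VU H V U \<Phi>"
    and f: "f \<in> carr U" and e: "e \<in> carr W" and v: "v \<in> carr V" and a: "a \<in> carr H"
  shows "pair2 ev ve (tens W H e a)
           (to_tensor V U (emb_UV H V) (psi_VU H V U \<Phi>) (tens V U v f)) =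
         matrix_coeff H V \<Phi> f e a v"
proof -
  define t where "t = to_tensor V U (emb_UV H V) (psi_VU H V U \<Phi>) (tens V U v f)"
  have t: "t \<in> carr (U \<otimes> V)" "emb_UV H V t = psi_VU H V U \<Phi> (tens V U v f)"
    using to_tensor_spec bij tens_in_tensor[OF v f] unfolding t_def bij_VU_def by blast+
  have eV: "e \<in> carr (dual V)" and "is_vspace W" using W e by (auto simp: is_subspace_of_def)
  note dV = is_subspace_of_refl[OF is_vspace_dual[OF V]]
  have "pair2 ev ve (tens W H e a) t = t (\<lambda>x y. ev e y * ve a x)"
    by (rule pair2_tens[OF \<open>is_vspace W\<close> H bilinmap_ev[OF W] bilinmap_ve[OF U] t(1) e a])
  also have "\<dots> = emb_UV H V t (tens H (dual V) a e)"
    unfolding emb_UV_def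
    by (simp add: emb_tens[OF H is_vspace_dual[OF V] bilinmap_ev[OF U] bilinmap_ve[OF dV] t(1) a eV]
        ev_def ve_def mult.commute)
  also have "\<dots> = matrix_coeff H V \<Phi> f e a v"
    using t(2) psi_VU_tens[OF U v f a eV] by simp
  finally show ?thesis by (simp add: t_def)
qed

text \<open>Both maps are now given by \<open>matrix_coeff H V \<Phi> f e a v\<close> for \<open>f\<close>, \<open>e\<close>, \<open>v\<close> and \<open>a\<close> in
  the carriers, and tensors see nothing else.\<close>

theorem psi_UW_via_WH_eq_via_VU:
  assumes U: "is_subspace_of U (dual H)" and W: "is_subspace_of W (dual V)"
    and "bij_WH H V W \<Phi>" "bij_VU H V U \<Phi>" and t: "t \<in> carr (U \<otimes> W)"
  shows "psi_UW_via_WH H V U W \<Phi> t = psi_UW_via_VU H V U W \<Phi> t"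
proof -
  have "is_vspace U" "is_vspace W" using U W by (auto simp: is_subspace_of_def)
  then show ?thesis
    unfolding psi_UW_via_WH_def psi_UW_via_VU_def using assms
    by (intro dual_map_cong[OF _ _ V H t]) (simp_all add: pair2_psi_WH pair2_psi_VU)
qed

end

lemma bij_UW_cong:
  assumes "\<And>t. t \<in> carr (U \<otimes> W) \<Longrightarrow> \<psi> t = \<psi>' t"
  shows "bij_UW H V U W \<psi> \<longleftrightarrow> bij_UW H V U W \<psi>'"
  unfolding bij_UW_def bij_flip_def by (rule bij_betw_cong[OF assms])

section \<open>Exchanging the two spaces\<close>

text \<open>For \<open>\<Phi> : V \<otimes> H \<rightarrow> H \<otimes> V\<close> the two factors of the domain trade places. The definitions for
  this case are literally those for \<open>V \<otimes> H\<close> in place of \<open>H \<otimes> V\<close>, so the agreement proved above carries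
  over.\<close>

lemma bij_UV_swap: "bij_UV H V U \<Phi> = bij_WH V H U \<Phi>"
  by (simp add: bij_UV_def bij_WH_def emb_VU_def emb_HW_def psi_UV_def psi_WH_def)

lemma bij_HW_swap: "bij_HW H V W \<Phi> = bij_VU V H W \<Phi>"
  by (simp add: bij_HW_def bij_VU_def emb_WH_def emb_UV_def psi_HW_def psi_VU_def)

lemma bij_WU_swap: "bij_WU H V U W \<psi> = bij_UW V H W U \<psi>"
  by (simp add: bij_WU_def bij_UW_def)

lemma psi_WU_via_UV_swap: "psi_WU_via_UV H V U W \<Phi> = psi_UW_via_WH V H W U \<Phi>"
  by (simp add: psi_WU_via_UV_def psi_UW_via_WH_def emb_VU_def emb_HW_def psi_UV_def psi_WH_def)

lemma psi_WU_via_HW_swap: "psi_WU_via_HW H V U W \<Phi> = psi_UW_via_VU V H W U \<Phi>"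
  by (simp add: psi_WU_via_HW_def psi_UW_via_VU_def emb_WH_def emb_UV_def psi_HW_def psi_VU_def)

lemma psi_WU_via_UV_eq_via_HW:
  assumes "is_vspace H" "is_vspace V" "linmap (V \<otimes> H) (H \<otimes> V) \<Phi>"
    and "is_subspace_of U (dual H)" "is_subspace_of W (dual V)"
    and "bij_HW H V W \<Phi>" "bij_UV H V U \<Phi>" and "t \<in> carr (W \<otimes> U)"
  shows "psi_WU_via_UV H V U W \<Phi> t = psi_WU_via_HW H V U W \<Phi> t"
  unfolding psi_WU_via_UV_swap psi_WU_via_HW_swap
  using assms by (intro psi_UW_via_WH_eq_via_VU) (simp_all add: bij_UV_swap bij_HW_swap)

lemma bij_WU_cong:
  assumes "\<And>t. t \<in> carr (W \<otimes> U) \<Longrightarrow> \<psi> t = \<psi>' t"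
  shows "bij_WU H V U W \<psi> \<longleftrightarrow> bij_WU H V U W \<psi>'"
  unfolding bij_WU_swap by (rule bij_UW_cong[OF assms])

section \<open>Duality for braided vector spaces\<close>

theorem lemma5p3:
  fixes H :: "('k::field, 'h::ab_group_add) vspace"
    and V :: "('k, 'v::ab_group_add) vspace"
    and U :: "('k, 'h \<Rightarrow> 'k) vspace"
    and W :: "('k, 'v \<Rightarrow> 'k) vspace"
  assumes "braided H \<Psi>HH"
    and "is_vspace V"
    and "is_subspace_of U (dual H)" and "nondegenerate U H"
    and "is_subspace_of W (dual V)" and "nondegenerate W V"
    and "bij_UU H U \<Psi>HH"
  shows
    "(\<forall>\<Psi>HV. left_braided H \<Psi>HH V \<Psi>HV \<and> bij_WH H V W \<Psi>HV \<and> bij_VU H V U \<Psi>HV \<longrightarrow>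
        (let A = psi_UW_via_WH H V U W \<Psi>HV; B = psi_UW_via_VU H V U W \<Psi>HV
         in bij_UW H V U W A \<or> bij_UW H V U W B \<longrightarrow>
              bij_UW H V U W A \<and> bij_UW H V U W B \<and> (\<forall>t\<in>carr (U \<otimes> W). A t = B t)))
     \<and>
     (\<forall>\<Psi>HV. left_braided H \<Psi>HH V \<Psi>HV \<longrightarrow>
        (let \<Phi> = inv_map (H \<otimes> V) \<Psi>HV
         in bij_HW H V W \<Phi> \<and> bij_UV H V U \<Phi> \<longrightarrow>
              (let A = psi_WU_via_UV H V U W \<Phi>; B = psi_WU_via_HW H V U W \<Phi>
               in bij_WU H V U W A \<or> bij_WU H V U W B \<longrightarrow>
                    (\<forall>t\<in>carr (W \<otimes> U). A t = B t))))
     \<and>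
     (\<forall>\<Psi>VH. right_braided H \<Psi>HH V \<Psi>VH \<longrightarrow>
        (bij_HW H V W \<Psi>VH \<and> bij_UV H V U \<Psi>VH \<longrightarrow>
           (let A = psi_WU_via_UV H V U W \<Psi>VH; B = psi_WU_via_HW H V U W \<Psi>VH
            in bij_WU H V U W A \<or> bij_WU H V U W B \<longrightarrow>
                 bij_WU H V U W A \<and> bij_WU H V U W B \<and> (\<forall>t\<in>carr (W \<otimes> U). A t = B t)))
        \<and>
        (let \<Phi> = inv_map (V \<otimes> H) \<Psi>VH
         in bij_VU H V U \<Phi> \<and> bij_WH H V W \<Phi> \<longrightarrow>
              (let A = psi_UW_via_VU H V U W \<Phi>; B = psi_UW_via_WH H V U W \<Phi>
               in bij_UW H V U W A \<or> bij_UW H V U W B \<longrightarrow>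
                    (\<forall>t\<in>carr (U \<otimes> W). A t = B t))))"
proof -
  have H: "is_vspace H" using assms(1) by (simp add: braided_def)
  note V = assms(2) and U = assms(3) and W = assms(5)
  \<comment> \<open>The maps marked with a circle belong to the inverse of the braiding, so each handedness
    supplies one linear map in either direction.\<close>
  have left: "linmap (H \<otimes> V) (V \<otimes> H) \<Psi>HV"
      "linmap (V \<otimes> H) (H \<otimes> V) (inv_map (H \<otimes> V) \<Psi>HV)"
    if "left_braided H \<Psi>HH V \<Psi>HV" for \<Psi>HV
    using that linmap_inv_map[OF is_vspace_tensor] by (auto simp: left_braided_def lin_iso_def)
  have right: "linmap (V \<otimes> H) (H \<otimes> V) \<Psi>VH"
      "linmap (H \<otimes> V) (V \<otimes> H) (inv_map (V \<otimes> H) \<Psi>VH)"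
    if "right_braided H \<Psi>HH V \<Psi>VH" for \<Psi>VH
    using that linmap_inv_map[OF is_vspace_tensor] by (auto simp: right_braided_def lin_iso_def)
  have UW: "(bij_UW H V U W (psi_UW_via_WH H V U W \<Phi>) \<longleftrightarrow> bij_UW H V U W (psi_UW_via_VU H V U W \<Phi>)) \<and>
      (\<forall>t\<in>carr (U \<otimes> W). psi_UW_via_WH H V U W \<Phi> t = psi_UW_via_VU H V U W \<Phi> t)"
    if "linmap (H \<otimes> V) (V \<otimes> H) \<Phi>" "bij_WH H V W \<Phi>" "bij_VU H V U \<Phi>" for \<Phi>
    using psi_UW_via_WH_eq_via_VU[OF H V that(1) U W that(2,3)] bij_UW_cong by blast
  have WU: "(bij_WU H V U W (psi_WU_via_UV H V U W \<Phi>) \<longleftrightarrow> bij_WU H V U W (psi_WU_via_HW H V U W \<Phi>)) \<and>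
      (\<forall>t\<in>carr (W \<otimes> U). psi_WU_via_UV H V U W \<Phi> t = psi_WU_via_HW H V U W \<Phi> t)"
    if "linmap (V \<otimes> H) (H \<otimes> V) \<Phi>" "bij_HW H V W \<Phi>" "bij_UV H V U \<Phi>" for \<Phi>
    using psi_WU_via_UV_eq_via_HW[OF H V that(1) U W that(2,3)] bij_WU_cong by blast
  show ?thesis
    unfolding Let_def
    by (intro conjI allI impI) (use left right UW WU in metis)+
qed

end
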